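(* Let $0<\lambda_p<\mu$, $\sigma\ge 0$, $a,b,c>0$, $\psi=(1+\sigma^2\mu^2)/2$, and let $S_p>\hat S_p:=\frac{\lambda_p\psi}{\mu(\mu-\lambda_p)}$ and $\frac ac>\frac{\lambda_p}{\mu^2}\psi$. Let $(\lambda_s^*,\theta^*,S_s^*,\beta^* )$ be the tuple produced by the finite step algorithm described in the context. Then $(\lambda_s^*,\theta^*,S_s^*,\beta^* )$ is a revenue maximal Nash equilibrium of the two-player non-cooperative constrained game between the service-provider and the user-set described in the context. That is, it is a Nash equilibrium, and $\theta^*\lambda_s^*\ge\theta\lambda_s$ for every Nash equilibrium $(\lambda_s,\theta,S_s,\beta)$ of the game.
   Context: Setting: a single-server M/G/1 queue with two customer classes, primary (Poisson arrival rate $\lambda_p$) and secondary (Poisson arrival rate $\lambda_s$), with i.i.d. service times of mean $1/\mu$ and variance $\sigma^2$. The queue is operated under the non-preemptive delay dependent priority discipline with parameter $\beta\in[0,\infty]$. For $0\le\lambda_s<\mu-\lambda_p$ and $\lambda=\lambda_p+\lambda_s$, the mean waiting times are $W_p(\lambda_s,\beta)=\frac{\lambda\psi(\mu-\lambda(1-\beta))}{\mu(\mu-\lambda)(\mu-\lambda_p(1-\beta))}$ and $W_s(\lambda_s,\beta)=\frac{\lambda\psi}{(\mu-\lambda)(\mu-\lambda_p(1-\beta))}$ if $0\le\beta\le1$; $W_p(\lambda_s,\beta)=\frac{\lambda\psi}{(\mu-\lambda)(\mu-\lambda_s(1-1/\beta))}$ and $W_s(\lambda_s,\beta)=\frac{\lambda\psi(\mu-\lambda(1-1/\beta))}{\mu(\mu-\lambda)(\mu-\lambda_s(1-1/\beta))}$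 if $1<\beta\le\infty$ (with $1/\infty=0$). Game: Player 1 (service-provider) chooses $(\theta,S_s,\beta)$; player 2 (user-set) chooses $\lambda_s\ge0$. A best response of player 1 to $\bar\lambda_s$ is an optimal solution of O1: maximize $\theta\bar\lambda_s$ over $(\theta,S_s,\beta)$ subject to $W_p(\bar\lambda_s,\beta)\le S_p$, $W_s(\bar\lambda_s,\beta)\le S_s$, $\bar\lambda_s<\mu-\lambda_p$, $\bar\lambda_s\le a-b\theta-cS_s$, $\theta,S_s\ge0$, $\beta\in[0,\infty]$. A best response of player 2 to $(\bar\theta,\bar S_s,\bar\beta)$ is an optimal solution of O2: maximize $\lambda_s$ over $\lambda_s\ge 0$ subject to $\lambda_s\le a-b\bar\theta-c\bar S_s$. A tuple $(\lambda_s,\theta,S_s,\beta)$ is a Nash equilibrium if $(\theta,S_s,\beta)$ is a best response to $\lambda_s$ and $\lambda_s$ is a best response to $(\theta,S_s,\beta)$. The revenue at such a tuple is $\theta\lambda_s$. Finite step algorithm (for $S_p>\hat S_p$ and $a/c>\lambda_p\psi/\mu^2$; it solves the joint problem P0 of maximizing $\theta\lambda_s$ over all $(\lambda_s,\theta,S_s,\beta)$ satisfying the constraints of O1 with $\bar\lambda_s=\lambda_s\ge0$). Let $\phi_0=\mu-\lambda_p$ and $G(x)=2\mu x^3-[c\psi+\mu(a+4\phi_0)]x^2+2\phi_0[c\psi+\mu(a+\phi_0)]x-a\mu\phi_0^2+c\psi\lambda_p(\mu+\phi_0)$, $\tilde G(x)=2\mu x^3-[a\mu+c\psi+4\mu^2]x^2+2\mu[a\mu+c\psi+\mu^2]x-\mu[a\mu^2-c\psi\lambda_p]$,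 $\lambda_s^{(4)}=\frac{1}{2S_p}\left[S_p(2\mu-\lambda_p)+\psi-\sqrt{(S_p\lambda_p+\psi)^2+4\mu\psi S_p}\right]$. Step A. If $\frac{\mu-\lambda_p}{\mu\lambda_p}\le\frac{a\lambda_p-c\psi}{2\mu\lambda_p^2+c\psi(\mu+\lambda_p)}$, set $J_l=\infty$. Otherwise let $\lambda_s^{(3)}$ be the unique root of $\tilde G$ in $(0,\mu-\lambda_p)$, $\lambda_3=\lambda_p+\lambda_s^{(3)}$, $J_l=\frac{\psi\lambda_3}{(\mu-\lambda_s^{(3)})(\mu-\lambda_3)}$; if $S_p>J_l$, set $\lambda_s^*=\lambda_s^{(3)}$, $\beta^*=\infty$ and go to Step D. Step B. If $\frac ac\le\frac{\lambda_p(2\mu-\lambda_p)}{\mu(\mu-\lambda_p)^2}\psi$, set $\lambda_s^*=\lambda_s^{(4)}$, $\beta^*=\infty$ and go to Step D. Step C. Otherwise let $\lambda_s^{(1)}$ be the unique root of $G$ in $(0,\mu-\lambda_p)$, $\lambda_1=\lambda_p+\lambda_s^{(1)}$, $I_l=\frac{\psi\lambda_1}{\mu(\mu-\lambda_p)}$, $I_u=\frac{\psi\lambda_1}{(\mu-\lambda_s^{(1)})(\mu-\lambda_1)}$. (i) If $\hat S_p<S_p<I_l$: $\lambda_s^*=\frac{\mu(\mu-\lambda_p)S_p}{\psi}-\lambda_p$, $\beta^*=0$. (ii) If $I_l\le S_p<I_u$: $\lambda_s^*=\lambda_s^{(1)}$, and $\beta^*=\frac{(\mu-\lambda_1)[\mu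 S_p(\mu-\lambda_p)-\psi\lambda_1]}{\psi\lambda_1^2-\mu S_p\lambda_p(\mu-\lambda_1)}$ if $S_p\le\frac{\psi\lambda_1}{\mu(\mu-\lambda_1)}$, while $\beta^*=\frac{S_p\lambda_s^{(1)}(\mu-\lambda_1)}{\psi\lambda_1-S_p(\mu-\lambda_s^{(1)})(\mu-\lambda_1)}$ if $S_p>\frac{\psi\lambda_1}{\mu(\mu-\lambda_1)}$. (iii) If $S_p\ge I_u$ (and $S_p\le J_l$): $\lambda_s^*=\lambda_s^{(4)}$, $\beta^*=\infty$. Step D. Set $S_s^*=W_s(\lambda_s^*,\beta^* )$ and $\theta^*=(a-cS_s^*-\lambda_s^* )/b$. *)

theory Defs
  imports "HOL-Analysis.Analysis"
begin

text \<open>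
  Parameters: \<open>lp\<close>, \<open>ls\<close> are the primary and secondary arrival rates, \<open>\<mu>\<close> is the service rate,
  \<open>\<psi> = (1 + \<sigma>\<^sup>2 \<mu>\<^sup>2) / 2\<close>, and \<open>a - b \<theta> - c Ss\<close> is the secondary demand. The priority
  parameter \<open>\<beta>\<close> ranges over \<open>[0, \<infinity>]\<close> and is an \<^typ>\<open>ereal\<close>; in the branches for
  \<open>\<beta> > 1\<close> the value of \<open>1 / \<beta>\<close> at \<open>\<beta> = \<infinity>\<close> is \<open>0\<close>, as the model requires.
  The waiting time formulas are meaningful for \<open>0 \<le> ls < \<mu> - lp\<close> and \<open>0 \<le> \<beta>\<close>.
\<close>

definition W_p :: "real \<Rightarrow> real \<Rightarrow> real \<Rightarrow> real \<Rightarrow> ereal \<Rightarrow> real" where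
  "W_p \<mu> \<psi> lp ls \<beta> =
    (let l = lp + ls in
     if \<beta> \<le> 1 then
       l * \<psi> * (\<mu> - l * (1 - real_of_ereal \<beta>))
         / (\<mu> * (\<mu> - l) * (\<mu> - lp * (1 - real_of_ereal \<beta>)))
     else
       l * \<psi> / ((\<mu> - l) * (\<mu> - ls * (1 - real_of_ereal (1 / \<beta>)))))"

definition W_s :: "real \<Rightarrow> real \<Rightarrow> real \<Rightarrow> real \<Rightarrow> ereal \<Rightarrow> real" where
  "W_s \<mu> \<psi> lp ls \<beta> =
    (let l = lp + ls in
     if \<beta> \<le> 1 then
       l * \<psi> / ((\<mu> - l) * (\<mu> - lp * (1 - real_of_ereal \<beta>)))
     else
       l * \<psi> * (\<mu> - l * (1 - real_of_ereal (1 / \<beta>)))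
         / (\<mu> * (\<mu> - l) * (\<mu> - ls * (1 - real_of_ereal (1 / \<beta>)))))"

definition O1_feasible ::
    "real \<Rightarrow> real \<Rightarrow> real \<Rightarrow> real \<Rightarrow> real \<Rightarrow> real \<Rightarrow> real \<Rightarrow> real \<Rightarrow> real \<times> real \<times> ereal \<Rightarrow> bool" where
  "O1_feasible \<mu> \<psi> lp a b c Sp ls = (\<lambda>(\<theta>, Ss, \<beta>).
     W_p \<mu> \<psi> lp ls \<beta> \<le> Sp \<and>
     W_s \<mu> \<psi> lp ls \<beta> \<le> Ss \<and>
     ls < \<mu> - lp \<and>
     ls \<le> a - b * \<theta> - c * Ss \<and>
     0 \<le> \<theta> \<and> 0 \<le> Ss \<and> 0 \<le> \<beta>)"

definition provider_best_response ::
    "real \<Rightarrow> real \<Rightarrow> real \<Rightarrow> real \<Rightarrow> real \<Rightarrow> real \<Rightarrow> real \<Rightarrow> real \<Rightarrow> real \<times> real \<times> ereal \<Rightarrow> bool" where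
  "provider_best_response \<mu> \<psi> lp a b c Sp ls =
     is_arg_max (\<lambda>(\<theta>, Ss, \<beta>). \<theta> * ls) (O1_feasible \<mu> \<psi> lp a b c Sp ls)"

definition users_best_response ::
    "real \<Rightarrow> real \<Rightarrow> real \<Rightarrow> real \<times> real \<times> ereal \<Rightarrow> real \<Rightarrow> bool" where
  "users_best_response a b c = (\<lambda>(\<theta>, Ss, \<beta>).
     is_arg_max (\<lambda>ls. ls) (\<lambda>ls. 0 \<le> ls \<and> ls \<le> a - b * \<theta> - c * Ss))"

definition nash_equilibrium ::
    "real \<Rightarrow> real \<Rightarrow> real \<Rightarrow> real \<Rightarrow> real \<Rightarrow> real \<Rightarrow> real \<Rightarrow> real \<times> real \<times> real \<times> ereal \<Rightarrow> bool" where
  "nash_equilibrium \<mu> \<psi> lp a b c Sp = (\<lambda>(ls, \<theta>, Ss, \<beta>).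
     provider_best_response \<mu> \<psi> lp a b c Sp ls (\<theta>, Ss, \<beta>) \<and>
     users_best_response a b c (\<theta>, Ss, \<beta>) ls)"

definition G :: "real \<Rightarrow> real \<Rightarrow> real \<Rightarrow> real \<Rightarrow> real \<Rightarrow> real \<Rightarrow> real" where
  "G \<mu> \<psi> lp a c x =
    (let \<phi>0 = \<mu> - lp in
     2 * \<mu> * x ^ 3
     - (c * \<psi> + \<mu> * (a + 4 * \<phi>0)) * x ^ 2
     + 2 * \<phi>0 * (c * \<psi> + \<mu> * (a + \<phi>0)) * x
     - a * \<mu> * \<phi>0 ^ 2 + c * \<psi> * lp * (\<mu> + \<phi>0))"

definition G_tilde :: "real \<Rightarrow> real \<Rightarrow> real \<Rightarrow> real \<Rightarrow> real \<Rightarrow> real \<Rightarrow> real" where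
  "G_tilde \<mu> \<psi> lp a c x =
     2 * \<mu> * x ^ 3
     - (a * \<mu> + c * \<psi> + 4 * \<mu> ^ 2) * x ^ 2
     + 2 * \<mu> * (a * \<mu> + c * \<psi> + \<mu> ^ 2) * x
     - \<mu> * (a * \<mu> ^ 2 - c * \<psi> * lp)"

text \<open>
  The definite descriptions in \<open>ls1\<close> and \<open>ls3\<close> denote the unique root only in the cases where
  the algorithm uses it (negation of the test of Step B and of Step A, respectively).
\<close>

definition ls1 :: "real \<Rightarrow> real \<Rightarrow> real \<Rightarrow> real \<Rightarrow> real \<Rightarrow> real" where
  "ls1 \<mu> \<psi> lp a c = (THE x. 0 < x \<and> x < \<mu> - lp \<and> G \<mu> \<psi> lp a c x = 0)"

definition ls3 :: "real \<Rightarrow> real \<Rightarrow> real \<Rightarrow> real \<Rightarrow> real \<Rightarrow> real" where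
  "ls3 \<mu> \<psi> lp a c = (THE x. 0 < x \<and> x < \<mu> - lp \<and> G_tilde \<mu> \<psi> lp a c x = 0)"

definition ls4 :: "real \<Rightarrow> real \<Rightarrow> real \<Rightarrow> real \<Rightarrow> real" where
  "ls4 \<mu> \<psi> lp Sp =
     1 / (2 * Sp) *
       (Sp * (2 * \<mu> - lp) + \<psi> - sqrt ((Sp * lp + \<psi>) ^ 2 + 4 * \<mu> * \<psi> * Sp))"

definition J_l :: "real \<Rightarrow> real \<Rightarrow> real \<Rightarrow> real \<Rightarrow> real \<Rightarrow> ereal" where
  "J_l \<mu> \<psi> lp a c =
    (if (\<mu> - lp) / (\<mu> * lp) \<le> (a * lp - c * \<psi>) / (2 * \<mu> * lp ^ 2 + c * \<psi> * (\<mu> + lp))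
     then \<infinity>
     else let x = ls3 \<mu> \<psi> lp a c; l3 = lp + x in
       ereal (\<psi> * l3 / ((\<mu> - x) * (\<mu> - l3))))"

definition step_C :: "real \<Rightarrow> real \<Rightarrow> real \<Rightarrow> real \<Rightarrow> real \<Rightarrow> real \<Rightarrow> real \<times> ereal" where
  "step_C \<mu> \<psi> lp a c Sp =
    (let x = ls1 \<mu> \<psi> lp a c;
         l1 = lp + x;
         I_l = \<psi> * l1 / (\<mu> * (\<mu> - lp));
         I_u = \<psi> * l1 / ((\<mu> - x) * (\<mu> - l1))
     in
       if Sp < I_l then (\<mu> * (\<mu> - lp) * Sp / \<psi> - lp, 0)
       else if Sp < I_u then
         (x, if Sp \<le> \<psi> * l1 / (\<mu> * (\<mu> - l1))
             then ereal ((\<mu> - l1) * (\<mu> * Sp * (\<mu> - lp) - \<psi> * l1)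
                         / (\<psi> * l1 ^ 2 - \<mu> * Sp * lp * (\<mu> - l1)))
             else ereal (Sp * x * (\<mu> - l1)
                         / (\<psi> * l1 - Sp * (\<mu> - x) * (\<mu> - l1))))
       else (ls4 \<mu> \<psi> lp Sp, \<infinity>))"

text \<open>Steps A to C, which determine \<open>(ls, \<beta>)\<close>. The test \<open>J_l < Sp\<close> fails when \<open>J_l = \<infinity>\<close>.\<close>

definition steps_A_to_C :: "real \<Rightarrow> real \<Rightarrow> real \<Rightarrow> real \<Rightarrow> real \<Rightarrow> real \<Rightarrow> real \<times> ereal" where
  "steps_A_to_C \<mu> \<psi> lp a c Sp =
    (if J_l \<mu> \<psi> lp a c < ereal Sp then (ls3 \<mu> \<psi> lp a c, \<infinity>)
     else if a / c \<le> lp * (2 * \<mu> - lp) / (\<mu> * (\<mu> - lp) ^ 2) * \<psi> then (ls4 \<mu> \<psi> lp Sp, \<infinity>)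
     else step_C \<mu> \<psi> lp a c Sp)"

text \<open>The output is the tuple \<open>(ls, \<theta>, Ss, \<beta>)\<close>.\<close>

definition finite_step_algorithm ::
    "real \<Rightarrow> real \<Rightarrow> real \<Rightarrow> real \<Rightarrow> real \<Rightarrow> real \<Rightarrow> real \<Rightarrow> real \<times> real \<times> real \<times> ereal" where
  "finite_step_algorithm \<mu> \<psi> lp a b c Sp =
    (let (ls, \<beta>) = steps_A_to_C \<mu> \<psi> lp a c Sp;
         Ss = W_s \<mu> \<psi> lp ls \<beta>;
         \<theta> = (a - c * Ss - ls) / b
     in (ls, \<theta>, Ss, \<beta>))"

end

theory Submission
  imports Defs
begin

text \<open>
  The conservation law \<open>lp W_p + ls W_s = l\<^sup>2 \<psi> / (\<mu> (\<mu> - l))\<close> with \<open>l = lp + ls\<close> turns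
  \<open>W_p \<le> Sp\<close> into a lower bound for \<open>ls W_s\<close>; a second one is the value at \<open>\<beta> = \<infinity>\<close>.
  Hence the revenue (times \<open>b\<close>) at rate \<open>ls\<close> is at most the minimum of two concave functions of
  \<open>ls\<close>, one for \<open>\<beta> = \<infinity>\<close> and one for \<open>W_p = Sp\<close>, and this bound is attained. The two graphs cross
  at \<open>ls4\<close>, and \<open>G_tilde\<close> and \<open>G\<close> are negative multiples of the two derivatives, so
  every branch of the algorithm stops at the maximum of the minimum. A maximizer of the joint problem
  is in particular a best response of the provider, and the users respond by exhausting
  the demand \<open>a - b \<theta> - c Ss\<close>.
\<close>

section \<open>Waiting times: the conservation law and the two extreme priority rules\<close>

lemma W_conservation:
  assumes "0 < lp" "0 \<le> ls" "ls < \<mu> - lp" "0 \<le> \<beta>"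
  shows "lp * W_p \<mu> \<psi> lp ls \<beta> + ls * W_s \<mu> \<psi> lp ls \<beta>
    = (lp + ls)\<^sup>2 * \<psi> / (\<mu> * (\<mu> - lp - ls))"
proof (cases "\<beta> \<le> 1")
  case True
  then obtain r where r: "\<beta> = ereal r" "0 \<le> r" "r \<le> 1"
    using assms(4) by (cases \<beta>) auto
  define D where "D = \<mu> - lp * (1 - r)"
  have "lp * (1 - r) \<le> lp * 1" using assms r by (intro mult_left_mono) auto
  then have D: "D > 0" unfolding D_def using assms by linarith
  \<comment> \<open>Over the common denominator the weighted numerators add up to a multiple of
    \<open>D\<close>. This is the only factor containing the priority parameter, and it
    cancels.\<close>
  have "lp * (\<mu> - (lp + ls) * (1 - r)) + ls * \<mu> = (lp + ls) * D"
    by (simp add: D_def algebra_simps)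
  moreover have k: "\<mu> > 0" "\<mu> - (lp + ls) > 0" using assms by auto
  moreover have "lp * W_p \<mu> \<psi> lp ls \<beta> + ls * W_s \<mu> \<psi> lp ls \<beta> =
    (lp + ls) * \<psi> * (lp * (\<mu> - (lp + ls) * (1 - r)) + ls * \<mu>) / (\<mu> * (\<mu> - lp - ls) * D)"
  proof -
    have "lp * (A * N / (\<mu> * k * D)) + ls * (A / (k * D)) = A * (lp * N + ls * \<mu>) / (\<mu> * k * D)"
      if "k > 0" for A N k using that D k(1) by (simp add: field_simps)
    from this[OF k(2)] show ?thesis
      using True r unfolding W_p_def W_s_def Let_def by (simp add: D_def diff_diff_eq)
  qed
  ultimately show ?thesis using D by (simp add: power2_eq_square mult_ac)
next
  case False
  \<comment> \<open>At \<open>\<beta> = \<infinity>\<close> this is \<open>0\<close>, so infinite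
    priority is covered by the same computation.\<close>
  define s where "s = real_of_ereal (1 / \<beta>)"
  have s: "0 \<le> s" "s \<le> 1"
    using False by (cases \<beta>; simp add: s_def one_ereal_def)+
  define D where "D = \<mu> - ls * (1 - s)"
  have "ls * (1 - s) \<le> ls * 1" using assms s by (intro mult_left_mono) auto
  then have D: "D > 0" unfolding D_def using assms by linarith
  have "lp * \<mu> + ls * (\<mu> - (lp + ls) * (1 - s)) = (lp + ls) * D"
    by (simp add: D_def algebra_simps)
  moreover have k: "\<mu> > 0" "\<mu> - (lp + ls) > 0" using assms by auto
  moreover have "lp * W_p \<mu> \<psi> lp ls \<beta> + ls * W_s \<mu> \<psi> lp ls \<beta> =
    (lp + ls) * \<psi> * (lp * \<mu> + ls * (\<mu> - (lp + ls) * (1 - s))) / (\<mu> * (\<mu> - lp - ls) * D)"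
  proof -
    have "lp * (A / (k * D)) + ls * (A * N / (\<mu> * k * D)) = A * (lp * \<mu> + ls * N) / (\<mu> * k * D)"
      if "k > 0" for A N k using that D k(1) by (simp add: field_simps)
    from this[OF k(2)] show ?thesis
      using False unfolding W_p_def W_s_def Let_def by (simp add: D_def s_def diff_diff_eq)
  qed
  ultimately show ?thesis using D by (simp add: power2_eq_square)
qed

text \<open>Secondary customers wait least under absolute priority, and the left side is
  \<open>W_s\<close> at \<open>\<beta> = \<infinity>\<close>. For \<open>\<beta> \<le> 1\<close> the
  denominators compare factor by factor; for \<open>\<beta> > 1\<close> cross-multiplication leaves
  the surplus \<open>s * \<mu> * lp\<close>.\<close>

lemma W_s_ge_top:
  assumes "0 < lp" "0 \<le> ls" "ls < \<mu> - lp" "0 \<le> \<beta>" "0 < \<psi>"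
  shows "(lp + ls) * \<psi> / (\<mu> * (\<mu> - ls)) \<le> W_s \<mu> \<psi> lp ls \<beta>"
proof (cases "\<beta> \<le> 1")
  case True
  then obtain r where r: "\<beta> = ereal r" "0 \<le> r" "r \<le> 1"
    using assms(4) by (cases \<beta>) auto
  have "lp * (1 - r) \<le> lp * 1" "0 \<le> lp * (1 - r)"
    using assms r by (intro mult_left_mono mult_nonneg_nonneg; simp)+
  then have "0 < \<mu> - lp * (1 - r)" "\<mu> - lp * (1 - r) \<le> \<mu>" using assms by linarith+
  then have "(\<mu> - (lp + ls)) * (\<mu> - lp * (1 - r)) \<le> (\<mu> - ls) * \<mu>"
    using assms by (intro mult_mono) auto
  then show ?thesis
    using True r assms \<open>0 < \<mu> - lp * (1 - r)\<close> unfolding W_s_def Let_def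
    by (auto intro!: divide_left_mono mult_pos_pos simp: mult.commute)
next
  case False
  define s where "s = real_of_ereal (1 / \<beta>)"
  have s: "0 \<le> s" "s \<le> 1"
    using False by (cases \<beta>; simp add: s_def one_ereal_def)+
  define D where "D = \<mu> - ls * (1 - s)"
  have "ls * (1 - s) \<le> ls * 1" using assms s by (intro mult_left_mono) auto
  then have D: "D > 0" unfolding D_def using assms by linarith
  have pos: "\<mu> > 0" "\<mu> - (lp + ls) > 0" "\<mu> - ls > 0" using assms by auto
  have "(\<mu> - (lp + ls) * (1 - s)) * (\<mu> - ls) - (\<mu> - (lp + ls)) * D = s * \<mu> * lp"
    by (simp add: D_def algebra_simps)
  also have "\<dots> \<ge> 0" using s pos assms by simp
  finally have "(\<mu> - (lp + ls)) * D \<le> (\<mu> - (lp + ls) * (1 - s)) * (\<mu> - ls)" by simp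
  then have le: "1 / (\<mu> - ls) \<le> (\<mu> - (lp + ls) * (1 - s)) / ((\<mu> - (lp + ls)) * D)"
    using pos D by (simp add: divide_simps mult_ac)
  have "(lp + ls) * \<psi> / (\<mu> * (\<mu> - ls)) = (lp + ls) * \<psi> / \<mu> * (1 / (\<mu> - ls))" by simp
  also have "\<dots> \<le> (lp + ls) * \<psi> / \<mu> *
      ((\<mu> - (lp + ls) * (1 - s)) / ((\<mu> - (lp + ls)) * D))"
    using assms pos by (intro mult_left_mono[OF le]) auto
  also have "\<dots> = W_s \<mu> \<psi> lp ls \<beta>"
    using False unfolding W_s_def Let_def by (simp add: s_def[symmetric] D_def[symmetric])
  finally show ?thesis .
qed

text \<open>Mirror image of the previous bound with the classes exchanged: the left side is
  \<open>W_p\<close> at \<open>\<beta> = 0\<close>. It limits the rates that are compatible with a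
  small \<open>Sp\<close>.\<close>

lemma W_p_ge_zero_priority:
  assumes "0 < lp" "0 \<le> ls" "ls < \<mu> - lp" "0 \<le> \<beta>" "0 < \<psi>"
  shows "(lp + ls) * \<psi> / (\<mu> * (\<mu> - lp)) \<le> W_p \<mu> \<psi> lp ls \<beta>"
proof (cases "\<beta> \<le> 1")
  case True
  then obtain r where r: "\<beta> = ereal r" "0 \<le> r" "r \<le> 1"
    using assms(4) by (cases \<beta>) auto
  define D where "D = \<mu> - lp * (1 - r)"
  have "lp * (1 - r) \<le> lp * 1" using assms r by (intro mult_left_mono) auto
  then have D: "D > 0" unfolding D_def using assms by linarith
  have pos: "\<mu> > 0" "\<mu> - (lp + ls) > 0" "\<mu> - lp > 0" using assms by auto
  have "(\<mu> - (lp + ls) * (1 - r)) * (\<mu> - lp) - (\<mu> - (lp + ls)) * D = r * \<mu> * ls"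
    by (simp add: D_def algebra_simps)
  also have "\<dots> \<ge> 0" using r pos assms by simp
  finally have "(\<mu> - (lp + ls)) * D \<le> (\<mu> - (lp + ls) * (1 - r)) * (\<mu> - lp)" by simp
  then have le: "1 / (\<mu> - lp) \<le> (\<mu> - (lp + ls) * (1 - r)) / ((\<mu> - (lp + ls)) * D)"
    using pos D by (simp add: divide_simps mult_ac)
  have "(lp + ls) * \<psi> / (\<mu> * (\<mu> - lp)) = (lp + ls) * \<psi> / \<mu> * (1 / (\<mu> - lp))" by simp
  also have "\<dots> \<le> (lp + ls) * \<psi> / \<mu> *
      ((\<mu> - (lp + ls) * (1 - r)) / ((\<mu> - (lp + ls)) * D))"
    using assms pos by (intro mult_left_mono[OF le]) auto
  also have "\<dots> = W_p \<mu> \<psi> lp ls \<beta>"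
    using True r unfolding W_p_def Let_def by (simp add: D_def[symmetric])
  finally show ?thesis .
next
  case False
  define s where "s = real_of_ereal (1 / \<beta>)"
  have s: "0 \<le> s" "s \<le> 1"
    using False by (cases \<beta>; simp add: s_def one_ereal_def)+
  have "ls * (1 - s) \<le> ls * 1" "0 \<le> ls * (1 - s)"
    using assms s by (intro mult_left_mono mult_nonneg_nonneg; simp)+
  then have "0 < \<mu> - ls * (1 - s)" "\<mu> - ls * (1 - s) \<le> \<mu>" using assms by linarith+
  then have "(\<mu> - (lp + ls)) * (\<mu> - ls * (1 - s)) \<le> (\<mu> - lp) * \<mu>"
    using assms by (intro mult_mono) auto
  then show ?thesis
    using False assms \<open>0 < \<mu> - ls * (1 - s)\<close> unfolding W_p_def Let_def
    by (auto intro!: divide_left_mono mult_pos_pos simp: mult.commute s_def[symmetric])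
qed

lemma W_p_top: "W_p \<mu> \<psi> lp ls \<infinity> = (lp + ls) * \<psi> / ((\<mu> - lp - ls) * (\<mu> - ls))"
  by (simp add: W_p_def Let_def one_ereal_def diff_diff_eq)

lemma W_s_top:
  assumes "lp + ls < \<mu>"
  shows "W_s \<mu> \<psi> lp ls \<infinity> = (lp + ls) * \<psi> / (\<mu> * (\<mu> - ls))"
  using assms by (simp add: W_s_def Let_def one_ereal_def)

section \<open>Tangent inequalities for convex reciprocals and concave revenues\<close>

lemma reciprocal_tangent:
  fixes x y m k :: real
  assumes "x < m" "y < m" "0 \<le> k"
  shows "k / (m - x) + k / (m - x)\<^sup>2 * (y - x) \<le> k / (m - y)"
proof -
  define u v where "u = m - x" and "v = m - y"
  have uv: "u > 0" "v > 0" "y - x = u - v" using assms by (auto simp: u_def v_def)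
  have "k / v - (k / u + k / u\<^sup>2 * (u - v)) = k * (u - v)\<^sup>2 / (v * u\<^sup>2)"
    using uv(1,2) by (simp add: field_simps power2_eq_square)
  also have "\<dots> \<ge> 0" using uv(1,2) assms by simp
  finally show ?thesis unfolding uv(3) u_def[symmetric] v_def[symmetric] by simp
qed

text \<open>Common shape of both revenue bounds: a concave quadratic minus a nonnegative multiple of
  a convex reciprocal, up to affine terms. The quadratic lies below its tangent by
  \<open>(y - x)^2\<close>.\<close>

lemma concave_tangent:
  fixes x y m k K p d :: real
  assumes "x < m" "y < m" "0 \<le> k" "0 \<le> K"
  shows "y * (p - y) - K * (k / (m - y) - y - d)
    \<le> x * (p - x) - K * (k / (m - x) - x - d) + (p - 2 * x - K * (k / (m - x)\<^sup>2 - 1)) * (y - x)"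
proof -
  have "K * (A - C + B * (y - x)) \<le> 0 \<Longrightarrow>
    y * (p - y) - K * (C - y - d) \<le> x * (p - x) - K * (A - x - d) + (p - 2 * x - K * (B - 1)) * (y - x)"
    for A B C
    using zero_le_square[of "y - x"] by (simp add: algebra_simps)
  moreover have "K * (k / (m - x) - k / (m - y) + k / (m - x)\<^sup>2 * (y - x)) \<le> 0"
    using reciprocal_tangent[OF assms(1-3)] assms(4) by (intro mult_nonneg_nonpos) auto
  ultimately show ?thesis by blast
qed

section \<open>The two concave revenue bounds and their derivatives\<close>

text \<open>At secondary rate \<open>0\<close> the primary waiting time is the right side of
  \<open>Sp_gt\<close>, and the secondary one under \<open>\<beta> = \<infinity>\<close> is the
  right side of \<open>ac_gt\<close>. So both constraints have slack near rate
  \<open>0\<close>.\<close>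

locale pricing_model =
  fixes \<mu> \<psi> lp a b c Sp :: real
  assumes lp_pos: "0 < lp" and lp_less: "lp < \<mu>" and psi_pos: "0 < \<psi>"
    and b_pos: "0 < b" and c_pos: "0 < c"
    and Sp_gt: "Sp > lp * \<psi> / (\<mu> * (\<mu> - lp))"
    and ac_gt: "a / c > lp / \<mu> ^ 2 * \<psi>"
begin

lemma mu_pos: "0 < \<mu>" using lp_pos lp_less by simp

lemma Sp_pos: "0 < Sp"
proof -
  have "0 \<le> lp * \<psi> / (\<mu> * (\<mu> - lp))" using lp_pos lp_less psi_pos mu_pos by simp
  then show ?thesis using Sp_gt by linarith
qed

text \<open>The scaled revenue \<open>b \<theta> ls\<close> when \<open>\<beta> = \<infinity>\<close> (\<open>R1\<close>) or \<open>W_p = Sp\<close> (\<open>R2\<close>), with derivatives.\<close>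

definition R1 where "R1 x = x * (a - x) - c * (x * ((lp + x) * \<psi> / (\<mu> * (\<mu> - x))))"
definition R2 where
  "R2 x = x * (a - x) - c * ((lp + x)\<^sup>2 * \<psi> / (\<mu> * (\<mu> - lp - x)) - lp * Sp)"
definition R1' where "R1' x = a - 2 * x - c * \<psi> / \<mu> * (\<mu> * (\<mu> + lp) / (\<mu> - x)\<^sup>2 - 1)"
definition R2' where "R2' x = a - 2 * x - c * \<psi> / \<mu> * (\<mu>\<^sup>2 / (\<mu> - lp - x)\<^sup>2 - 1)"

lemma R1_tangent:
  assumes "x < \<mu>" "y < \<mu>"
  shows "R1 y \<le> R1 x + R1' x * (y - x)"
proof -
  \<comment> \<open>Partial fractions of \<open>z * (lp + z) / (\<mu> - z)\<close> produce the shape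
    of \<open>concave_tangent\<close>.\<close>
  have eq: "R1 z = z * (a - z) - c * \<psi> / \<mu> * (\<mu> * (\<mu> + lp) / (\<mu> - z) - z - (lp + \<mu>))"
    if "z < \<mu>" for z
    using that mu_pos by (simp add: R1_def field_simps)
  show ?thesis
    unfolding eq[OF assms(1)] eq[OF assms(2)] R1'_def
    using assms mu_pos lp_pos c_pos psi_pos by (intro concave_tangent) auto
qed

lemma R2_tangent:
  assumes "x < \<mu> - lp" "y < \<mu> - lp"
  shows "R2 y \<le> R2 x + R2' x * (y - x)"
proof -
  \<comment> \<open>Division of \<open>(lp + z)^2\<close> by \<open>\<mu> - lp - z\<close> with
    remainder \<open>\<mu>^2\<close>; the \<open>Sp\<close> term is a constant.\<close>
  have eq: "R2 z = z * (a - z) - c * \<psi> / \<mu> * (\<mu>\<^sup>2 / (\<mu> - lp - z) - z - (lp + \<mu>)) + c * lp * Sp"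
    if "z < \<mu> - lp" for z
  proof -
    define v where "v = \<mu> - lp - z"
    have "v > 0" and z: "z = \<mu> - lp - v" using that by (auto simp: v_def)
    then show ?thesis unfolding R2_def v_def[symmetric] using mu_pos
      by (simp add: z field_simps power2_eq_square)
  qed
  have "y * (a - y) - c * \<psi> / \<mu> * (\<mu>\<^sup>2 / (\<mu> - lp - y) - y - (lp + \<mu>))
    \<le> x * (a - x) - c * \<psi> / \<mu> * (\<mu>\<^sup>2 / (\<mu> - lp - x) - x - (lp + \<mu>)) + R2' x * (y - x)"
    unfolding R2'_def using assms mu_pos c_pos psi_pos by (intro concave_tangent) auto
  then show ?thesis
    unfolding eq[OF assms(1)] eq[OF assms(2)] by linarith
qed

text \<open>The term \<open>- 2 * x\<close> alone gives strictness. With its analogue for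
  \<open>R2'\<close> this makes critical points unique and reads the sign of a derivative off the
  position relative to its zero.\<close>

lemma R1'_strict_antimono:
  assumes "x < y" "y < \<mu>"
  shows "R1' y < R1' x"
proof -
  have "\<mu> * (\<mu> + lp) / (\<mu> - x)\<^sup>2 \<le> \<mu> * (\<mu> + lp) / (\<mu> - y)\<^sup>2"
    using assms mu_pos lp_pos by (intro divide_left_mono power_mono mult_pos_pos) auto
  then have "c * \<psi> / \<mu> * (\<mu> * (\<mu> + lp) / (\<mu> - x)\<^sup>2 - 1)
      \<le> c * \<psi> / \<mu> * (\<mu> * (\<mu> + lp) / (\<mu> - y)\<^sup>2 - 1)"
    using mu_pos c_pos psi_pos by (intro mult_left_mono) auto
  then show ?thesis using assms by (simp add: R1'_def)
qed

lemma R2'_strict_antimono: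
  assumes "x < y" "y < \<mu> - lp"
  shows "R2' y < R2' x"
proof -
  have "\<mu>\<^sup>2 / (\<mu> - lp - x)\<^sup>2 \<le> \<mu>\<^sup>2 / (\<mu> - lp - y)\<^sup>2"
    using assms by (intro divide_left_mono power_mono mult_pos_pos) auto
  then have "c * \<psi> / \<mu> * (\<mu>\<^sup>2 / (\<mu> - lp - x)\<^sup>2 - 1) \<le> c * \<psi> / \<mu> * (\<mu>\<^sup>2 / (\<mu> - lp - y)\<^sup>2 - 1)"
    using mu_pos c_pos psi_pos by (intro mult_left_mono) auto
  then show ?thesis using assms by (simp add: R2'_def)
qed

section \<open>The cubics as cleared first-order conditions, and their roots\<close>

lemma G_tilde_eq:
  assumes "x < \<mu>"
  shows "G_tilde \<mu> \<psi> lp a c x = - (\<mu> * (\<mu> - x)\<^sup>2 * R1' x)"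
proof -
  define v where "v = \<mu> - x"
  have "v > 0" and x: "x = \<mu> - v" using assms by (auto simp: v_def)
  have "\<mu> * v\<^sup>2 * R1' x = \<mu> * v\<^sup>2 * (a - 2 * x) - c * \<psi> * (\<mu> * (\<mu> + lp) - v\<^sup>2)"
    using \<open>v > 0\<close> mu_pos by (simp add: R1'_def v_def[symmetric] field_simps)
  then show ?thesis
    unfolding G_tilde_def v_def by (simp add: algebra_simps power2_eq_square power3_eq_cube)
qed

lemma G_eq:
  assumes "x < \<mu> - lp"
  shows "G \<mu> \<psi> lp a c x = - (\<mu> * (\<mu> - lp - x)\<^sup>2 * R2' x)"
proof -
  define v where "v = \<mu> - lp - x"
  have "v > 0" using assms by (auto simp: v_def)
  then have "\<mu> * v\<^sup>2 * R2' x = \<mu> * v\<^sup>2 * (a - 2 * x) - c * \<psi> * (\<mu>\<^sup>2 - v\<^sup>2)"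
    unfolding R2'_def v_def[symmetric] using mu_pos by (simp add: field_simps)
  then show ?thesis
    unfolding G_def Let_def v_def by (simp add: algebra_simps power2_eq_square power3_eq_cube)
qed

text \<open>Failure of the test of Step B says that \<open>G\<close> is negative at
  \<open>0\<close>, and \<open>G\<close> is positive at \<open>\<mu> - lp\<close>, where
  \<open>R2'\<close> has a pole. Existence therefore comes from the polynomial, uniqueness from the
  monotone derivative; together they justify the definite description.\<close>

lemma ls1_root:
  assumes "\<not> a / c \<le> lp * (2 * \<mu> - lp) / (\<mu> * (\<mu> - lp) ^ 2) * \<psi>"
  shows "0 < ls1 \<mu> \<psi> lp a c" "ls1 \<mu> \<psi> lp a c < \<mu> - lp" "R2' (ls1 \<mu> \<psi> lp a c) = 0"
proof -
  let ?G = "G \<mu> \<psi> lp a c"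
  have "\<exists>!x. 0 < x \<and> x < \<mu> - lp \<and> ?G x = 0"
  proof -
    have "a * (\<mu> * (\<mu> - lp)\<^sup>2) > c * \<psi> * lp * (2 * \<mu> - lp)"
      using assms c_pos mu_pos lp_less by (simp add: field_simps)
    then have neg: "?G 0 < 0"
      unfolding G_def Let_def by (simp add: algebra_simps)
    have "?G (\<mu> - lp) = c * \<psi> * \<mu>\<^sup>2"
      unfolding G_def Let_def by (simp add: algebra_simps power2_eq_square power3_eq_cube)
    then have pos: "?G (\<mu> - lp) > 0" using c_pos psi_pos mu_pos by simp
    have "continuous_on {0..\<mu> - lp} ?G"
      unfolding G_def Let_def by (intro continuous_intros)
    then obtain x where x: "0 \<le> x" "x \<le> \<mu> - lp" "?G x = 0"
      using IVT'[of ?G 0 0 "\<mu> - lp"] neg pos lp_less by auto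
    with neg pos have "0 < x \<and> x < \<mu> - lp \<and> ?G x = 0"
      by (metis less_eq_real_def less_irrefl)
    moreover have "y = z" if "0 < y \<and> y < \<mu> - lp \<and> ?G y = 0" "0 < z \<and> z < \<mu> - lp \<and> ?G z = 0" for y z
    proof -
      have "R2' y = 0" "R2' z = 0" using that mu_pos by (auto simp: G_eq)
      then show ?thesis
        using that R2'_strict_antimono[of y z] R2'_strict_antimono[of z y]
        by (cases y z rule: linorder_cases) auto
    qed
    ultimately show ?thesis by blast
  qed
  from theI'[OF this] have "0 < ls1 \<mu> \<psi> lp a c \<and> ls1 \<mu> \<psi> lp a c < \<mu> - lp \<and> ?G (ls1 \<mu> \<psi> lp a c) = 0"
    unfolding ls1_def .
  then show "0 < ls1 \<mu> \<psi> lp a c" "ls1 \<mu> \<psi> lp a c < \<mu> - lp" "R2' (ls1 \<mu> \<psi> lp a c) = 0"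
    using mu_pos by (auto simp: G_eq)
qed

text \<open>Cleared of denominators, the test is the sign of \<open>G_tilde\<close> at the stability
  limit: it asks whether \<open>R1\<close> is still nondecreasing there, hence has no peak at a
  smaller rate.\<close>

lemma step_A_test_iff:
  "(\<mu> - lp) / (\<mu> * lp) \<le> (a * lp - c * \<psi>) / (2 * \<mu> * lp ^ 2 + c * \<psi> * (\<mu> + lp))
    \<longleftrightarrow> 0 \<le> R1' (\<mu> - lp)"
proof -
  have d: "2 * \<mu> * lp ^ 2 + c * \<psi> * (\<mu> + lp) > 0"
    using mu_pos lp_pos c_pos psi_pos by (intro add_pos_pos mult_pos_pos) auto
  have "(\<mu> - lp) / (\<mu> * lp) \<le> (a * lp - c * \<psi>) / (2 * \<mu> * lp ^ 2 + c * \<psi> * (\<mu> + lp))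
    \<longleftrightarrow> (\<mu> - lp) * (2 * \<mu> * lp ^ 2 + c * \<psi> * (\<mu> + lp)) \<le> (a * lp - c * \<psi>) * (\<mu> * lp)"
    using d mu_pos lp_pos by (simp add: divide_le_eq le_divide_eq mult.commute)
  also have "\<dots> \<longleftrightarrow> 0 \<le> - G_tilde \<mu> \<psi> lp a c (\<mu> - lp)"
    unfolding G_tilde_def by (simp add: algebra_simps power2_eq_square power3_eq_cube)
  also have "\<dots> \<longleftrightarrow> 0 \<le> R1' (\<mu> - lp)"
    using mu_pos lp_pos by (simp add: G_tilde_eq zero_le_mult_iff mult_le_0_iff not_le)
  finally show ?thesis .
qed

text \<open>Sign change again: \<open>ac_gt\<close> makes \<open>G_tilde\<close> negative at
  \<open>0\<close>, and the hypothesis makes it positive at \<open>\<mu> - lp\<close>.\<close>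

lemma ls3_root:
  assumes "R1' (\<mu> - lp) < 0"
  shows "0 < ls3 \<mu> \<psi> lp a c" "ls3 \<mu> \<psi> lp a c < \<mu> - lp" "R1' (ls3 \<mu> \<psi> lp a c) = 0"
proof -
  let ?G = "G_tilde \<mu> \<psi> lp a c"
  have "\<exists>!x. 0 < x \<and> x < \<mu> - lp \<and> ?G x = 0"
  proof -
    have "a * \<mu> ^ 2 > c * \<psi> * lp"
      using ac_gt c_pos mu_pos by (simp add: field_simps)
    then have neg: "?G 0 < 0"
      unfolding G_tilde_def using mu_pos by simp
    have pos: "?G (\<mu> - lp) > 0"
      using assms mu_pos lp_pos by (simp add: G_tilde_eq mult_pos_neg)
    have "continuous_on {0..\<mu> - lp} ?G"
      unfolding G_tilde_def by (intro continuous_intros)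
    then obtain x where x: "0 \<le> x" "x \<le> \<mu> - lp" "?G x = 0"
      using IVT'[of ?G 0 0 "\<mu> - lp"] neg pos lp_less by auto
    with neg pos have "0 < x \<and> x < \<mu> - lp \<and> ?G x = 0"
      by (metis less_eq_real_def less_irrefl)
    moreover have "y = z" if "0 < y \<and> y < \<mu> - lp \<and> ?G y = 0" "0 < z \<and> z < \<mu> - lp \<and> ?G z = 0" for y z
    proof -
      have "R1' y = 0" "R1' z = 0" using that mu_pos lp_pos by (auto simp: G_tilde_eq)
      then show ?thesis
        using that lp_pos R1'_strict_antimono[of y z] R1'_strict_antimono[of z y]
        by (cases y z rule: linorder_cases) auto
    qed
    ultimately show ?thesis by blast
  qed
  from theI'[OF this] have "0 < ls3 \<mu> \<psi> lp a c \<and> ls3 \<mu> \<psi> lp a c < \<mu> - lp \<and> ?G (ls3 \<mu> \<psi> lp a c) = 0"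
    unfolding ls3_def .
  then show "0 < ls3 \<mu> \<psi> lp a c" "ls3 \<mu> \<psi> lp a c < \<mu> - lp" "R1' (ls3 \<mu> \<psi> lp a c) = 0"
    using mu_pos lp_pos by (auto simp: G_tilde_eq)
qed

section \<open>The rate at which the two bounds cross\<close>

text \<open>Translates comparisons of \<open>Sp\<close> with a waiting time at
  \<open>\<beta> = \<infinity>\<close> into comparisons of rates with \<open>ls4\<close>.\<close>

lemma W_p_top_strict_mono:
  assumes "0 \<le> x" "x < y" "y < \<mu> - lp"
  shows "W_p \<mu> \<psi> lp x \<infinity> < W_p \<mu> \<psi> lp y \<infinity>"
proof -
  have "(\<mu> - lp - y) * (\<mu> - y) \<le> (\<mu> - lp - x) * (\<mu> - x)"
    using assms lp_pos by (intro mult_mono) auto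
  then show ?thesis
    unfolding W_p_top using assms lp_pos psi_pos
    by (intro frac_less) auto
qed

text \<open>\<open>ls4\<close> is the smaller root of the quadratic
  \<open>Sp * (\<mu> - lp - x) * (\<mu> - x) = (lp + x) * \<psi>\<close>, which is
  \<open>W_p = Sp\<close> at \<open>\<beta> = \<infinity>\<close>. Here \<open>- B\<close> is its
  linear coefficient and \<open>D\<close> its discriminant.\<close>

lemma ls4_props:
  shows "0 < ls4 \<mu> \<psi> lp Sp" "ls4 \<mu> \<psi> lp Sp < \<mu> - lp" "W_p \<mu> \<psi> lp (ls4 \<mu> \<psi> lp Sp) \<infinity> = Sp"
proof -
  define D where "D = (Sp * lp + \<psi>) ^ 2 + 4 * \<mu> * \<psi> * Sp"
  define B where "B = Sp * (2 * \<mu> - lp) + \<psi>"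
  define x where "x = ls4 \<mu> \<psi> lp Sp"
  have x: "2 * Sp * x = B - sqrt D"
    using Sp_pos by (simp add: x_def ls4_def B_def D_def)
  have B: "B > 0" unfolding B_def using Sp_pos psi_pos lp_less mu_pos
    by (intro add_pos_pos mult_pos_pos) auto
  have D: "D > 0" unfolding D_def using Sp_pos psi_pos mu_pos
    by (intro add_nonneg_pos mult_pos_pos) auto
  \<comment> \<open>The constant term of the quadratic; its positivity is \<open>Sp_gt\<close> and
    yields \<open>sqrt D < B\<close>, so the root is positive.\<close>
  have C: "Sp * \<mu> * (\<mu> - lp) - \<psi> * lp > 0"
    using Sp_gt lp_less mu_pos by (simp add: field_simps)
  have BD: "B\<^sup>2 - D = 4 * Sp * (Sp * \<mu> * (\<mu> - lp) - \<psi> * lp)"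
    by (simp add: B_def D_def algebra_simps power2_eq_square)
  also have "\<dots> > 0" using C Sp_pos by simp
  finally have "sqrt D < B" using B by (intro real_less_lsqrt) auto
  then have "2 * Sp * x > 0" using x by simp
  then have x0: "x > 0" using Sp_pos by (simp add: zero_less_mult_iff)
  \<comment> \<open>The left side is \<open>B - 2 * Sp * (\<mu> - lp)\<close>, so this puts the root
    below \<open>\<mu> - lp\<close>.\<close>
  have "Sp * lp + \<psi> < sqrt D"
    unfolding D_def using Sp_pos psi_pos mu_pos by (intro real_less_rsqrt) auto
  then have "2 * Sp * x < 2 * Sp * (\<mu> - lp)" using x by (simp add: B_def algebra_simps)
  then have x1: "x < \<mu> - lp" using Sp_pos by simp
  have "(2 * Sp * x - B)\<^sup>2 = D" using x D by simp
  then have "4 * Sp * (Sp * x\<^sup>2 - B * x) = D - B\<^sup>2"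
    by (simp add: algebra_simps power2_eq_square)
  then have "4 * Sp * (Sp * x\<^sup>2 - B * x + (Sp * \<mu> * (\<mu> - lp) - \<psi> * lp)) = 0"
    using BD by (simp add: algebra_simps)
  then have "Sp * x\<^sup>2 - B * x + (Sp * \<mu> * (\<mu> - lp) - \<psi> * lp) = 0"
    using Sp_pos by simp
  then have "Sp * ((\<mu> - lp - x) * (\<mu> - x)) = (lp + x) * \<psi>"
    by (simp add: B_def algebra_simps power2_eq_square)
  moreover have "(\<mu> - lp - x) * (\<mu> - x) > 0" using x1 lp_pos by simp
  ultimately have "W_p \<mu> \<psi> lp x \<infinity> = Sp"
    unfolding W_p_top by (simp add: field_simps)
  with x0 x1 show "0 < ls4 \<mu> \<psi> lp Sp" "ls4 \<mu> \<psi> lp Sp < \<mu> - lp" "W_p \<mu> \<psi> lp (ls4 \<mu> \<psi> lp Sp) \<infinity> = Sp"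
    by (auto simp: x_def)
qed

section \<open>The joint problem reduced to rate and priority\<close>

text \<open>Price and secondary service level are eliminated: the best \<open>Ss\<close> is
  \<open>W_s\<close> and the best price exhausts the demand. Nonnegativity of the price is recovered
  at an optimum from positive revenue.\<close>

definition admissible where
  "admissible x \<beta> \<longleftrightarrow> 0 \<le> x \<and> x < \<mu> - lp \<and> 0 \<le> \<beta> \<and> W_p \<mu> \<psi> lp x \<beta> \<le> Sp"

text \<open>This is \<open>b * \<theta> * x\<close> for that eliminated price.\<close>

definition scaled_rev where "scaled_rev x \<beta> = x * (a - x) - c * (x * W_s \<mu> \<psi> lp x \<beta>)"

lemma scaled_rev_le_R1: "admissible x \<beta> \<Longrightarrow> scaled_rev x \<beta> \<le> R1 x"
  using W_s_ge_top[of lp x \<mu> \<beta> \<psi>] lp_pos psi_pos c_pos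
  by (simp add: admissible_def scaled_rev_def R1_def mult_left_mono del: times_divide_eq_right)

lemma scaled_rev_eq_R1: "x < \<mu> - lp \<Longrightarrow> scaled_rev x \<infinity> = R1 x"
  by (simp add: scaled_rev_def R1_def W_s_top)

text \<open>By the conservation law, secondary waiting can be traded for primary waiting, so the
  distance to \<open>R2\<close> is proportional to the slack in the primary constraint.\<close>

lemma scaled_rev_eq:
  assumes "0 \<le> x" "x < \<mu> - lp" "0 \<le> \<beta>"
  shows "scaled_rev x \<beta> = R2 x - c * (lp * (Sp - W_p \<mu> \<psi> lp x \<beta>))"
proof -
  have "x * W_s \<mu> \<psi> lp x \<beta> = (lp + x)\<^sup>2 * \<psi> / (\<mu> * (\<mu> - lp - x)) - lp * W_p \<mu> \<psi> lp x \<beta>"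
    using W_conservation[OF lp_pos assms, of \<psi>] by linarith
  then show ?thesis unfolding scaled_rev_def R2_def by (simp only: right_diff_distrib)
qed

lemma scaled_rev_le_R2: "admissible x \<beta> \<Longrightarrow> scaled_rev x \<beta> \<le> R2 x"
  using scaled_rev_eq[of x \<beta>] lp_pos c_pos by (simp add: admissible_def)

definition optimal where
  "optimal x \<beta> \<longleftrightarrow> 0 < x \<and> admissible x \<beta> \<and> (\<forall>y \<gamma>. admissible y \<gamma> \<longrightarrow> scaled_rev y \<gamma> \<le> scaled_rev x \<beta>)"

text \<open>At \<open>\<beta> = \<infinity>\<close> the revenue is \<open>x * ?h x\<close>, and
  \<open>?h 0 > 0\<close> is \<open>ac_gt\<close>. By continuity a small rate below
  \<open>ls4\<close> works. This forces a positive price at any optimum.\<close>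

lemma exists_positive_rev: "\<exists>x \<beta>. admissible x \<beta> \<and> 0 < scaled_rev x \<beta>"
proof -
  let ?h = "\<lambda>x. a - x - c * ((lp + x) * \<psi> / (\<mu> * (\<mu> - x)))"
  have "isCont ?h 0" using mu_pos by (intro continuous_intros) auto
  then have "(?h \<longlongrightarrow> ?h 0) (at_right 0)"
    by (simp add: isCont_def filterlim_at_split)
  moreover have "0 < ?h 0" using ac_gt c_pos mu_pos by (simp add: field_simps power2_eq_square)
  ultimately have "\<forall>\<^sub>F x in at_right 0. 0 < ?h x" by (rule order_tendstoD)
  moreover have "\<forall>\<^sub>F x in at_right 0. x \<in> {0<..<ls4 \<mu> \<psi> lp Sp}"
    using ls4_props(1) by (rule eventually_at_right_real)
  ultimately have "\<forall>\<^sub>F x in at_right 0. 0 < ?h x \<and> x \<in> {0<..<ls4 \<mu> \<psi> lp Sp}"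
    by (rule eventually_conj)
  then obtain x where x: "0 < ?h x" "0 < x" "x < ls4 \<mu> \<psi> lp Sp"
    using eventually_happens'[OF trivial_limit_at_right_real] by (metis (lifting) greaterThanLessThan_iff)
  have "admissible x \<infinity>"
    using x ls4_props W_p_top_strict_mono[of x "ls4 \<mu> \<psi> lp Sp"] by (simp add: admissible_def)
  moreover have "scaled_rev x \<infinity> = x * ?h x"
    using x ls4_props by (simp add: scaled_rev_eq_R1 R1_def algebra_simps)
  ultimately show ?thesis using x by (metis mult_pos_pos)
qed

section \<open>From the joint optimum to the game\<close>

lemma optimal_nash:
  assumes "optimal x \<beta>"
  defines "Ss \<equiv> W_s \<mu> \<psi> lp x \<beta>"
  defines "\<theta> \<equiv> (a - c * Ss - x) / b"
  shows "nash_equilibrium \<mu> \<psi> lp a b c Sp (x, \<theta>, Ss, \<beta>)"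
    and "nash_equilibrium \<mu> \<psi> lp a b c Sp (y, \<theta>', Ss', \<gamma>) \<Longrightarrow> \<theta>' * y \<le> \<theta> * x"
proof -
  have x: "0 < x" "x < \<mu> - lp" "0 \<le> \<beta>" "W_p \<mu> \<psi> lp x \<beta> \<le> Sp"
    using assms(1) by (auto simp: optimal_def admissible_def)
  have val: "\<theta> * x = scaled_rev x \<beta> / b"
    by (simp add: \<theta>_def Ss_def scaled_rev_def algebra_simps)
  \<comment> \<open>Used twice: at \<open>y = x\<close> it is the optimality of the provider's
    response, and at the rate of another equilibrium it is the revenue comparison, since every
    equilibrium is feasible for the joint problem.\<close>
  have bound: "\<theta>' * y \<le> \<theta> * x"
    if f: "O1_feasible \<mu> \<psi> lp a b c Sp y (\<theta>', Ss', \<gamma>)" and y: "0 \<le> y" for \<theta>' y Ss' \<gamma>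
  proof -
    have "admissible y \<gamma>" using f y by (simp add: O1_feasible_def admissible_def)
    then have "scaled_rev y \<gamma> \<le> scaled_rev x \<beta>" using assms(1) by (simp add: optimal_def)
    have "c * W_s \<mu> \<psi> lp y \<gamma> \<le> c * Ss'" using f c_pos by (simp add: O1_feasible_def)
    then have "b * \<theta>' \<le> a - c * W_s \<mu> \<psi> lp y \<gamma> - y" using f by (simp add: O1_feasible_def)
    from mult_left_mono[OF this y] have "b * (\<theta>' * y) \<le> scaled_rev y \<gamma>"
      by (simp add: scaled_rev_def algebra_simps)
    with \<open>scaled_rev y \<gamma> \<le> scaled_rev x \<beta>\<close> have "b * (\<theta>' * y) \<le> scaled_rev x \<beta>" by simp
    then show ?thesis unfolding val using b_pos by (simp add: field_simps)
  qed
  obtain z \<zeta> where "admissible z \<zeta>" "0 < scaled_rev z \<zeta>" using exists_positive_rev by blast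
  then have "0 < scaled_rev x \<beta>" using assms(1) unfolding optimal_def by (meson less_le_trans)
  then have "0 < \<theta> * x" using val b_pos by simp
  then have \<theta>: "0 < \<theta>" using x(1) by (simp add: zero_less_mult_iff)
  have "0 \<le> (lp + x) * \<psi> / (\<mu> * (\<mu> - x))" using x lp_pos psi_pos mu_pos by simp
  then have "0 \<le> Ss" using W_s_ge_top[of lp x \<mu> \<beta> \<psi>] x lp_pos psi_pos
    unfolding Ss_def by linarith
  \<comment> \<open>The demand constraint is tight, so \<open>x\<close> is the largest rate open to
    the users.\<close>
  have "b * \<theta> = a - c * Ss - x" using b_pos by (simp add: \<theta>_def)
  with \<theta> \<open>0 \<le> Ss\<close> x have feas: "O1_feasible \<mu> \<psi> lp a b c Sp x (\<theta>, Ss, \<beta>)"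
    by (simp add: O1_feasible_def Ss_def)
  show "nash_equilibrium \<mu> \<psi> lp a b c Sp (x, \<theta>, Ss, \<beta>)"
    unfolding nash_equilibrium_def provider_best_response_def users_best_response_def is_arg_max_def
    using feas bound[where y = x] x \<open>b * \<theta> = a - c * Ss - x\<close> by (force simp: not_less)
  show "\<theta>' * y \<le> \<theta> * x" if "nash_equilibrium \<mu> \<psi> lp a b c Sp (y, \<theta>', Ss', \<gamma>)"
  proof (rule bound)
    show "O1_feasible \<mu> \<psi> lp a b c Sp y (\<theta>', Ss', \<gamma>)" and "0 \<le> y"
      using that by (simp_all add: nash_equilibrium_def provider_best_response_def
          users_best_response_def is_arg_max_def)
  qed
qed

section \<open>Priority parameters that make the primary constraint tight\<close>

text \<open>The bounds on \<open>Sp\<close> are the values of \<open>W_p\<close> at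
  \<open>\<beta> = 0\<close> and \<open>\<beta> = 1\<close>. They give \<open>N \<ge> 0\<close> and
  \<open>N \<le> D\<close>, so the solution \<open>N / D\<close> of \<open>W_p = Sp\<close> stays in
  this branch.\<close>

lemma W_p_intermediate_le_1:
  assumes x: "0 < x" "x < \<mu> - lp"
    and ge: "\<psi> * (lp + x) / (\<mu> * (\<mu> - lp)) \<le> Sp" and le: "Sp \<le> \<psi> * (lp + x) / (\<mu> * (\<mu> - (lp + x)))"
  defines "\<beta> \<equiv> (\<mu> - (lp + x)) * (\<mu> * Sp * (\<mu> - lp) - \<psi> * (lp + x))
                         / (\<psi> * (lp + x) ^ 2 - \<mu> * Sp * lp * (\<mu> - (lp + x)))"
  shows "0 \<le> \<beta>" "W_p \<mu> \<psi> lp x (ereal \<beta>) = Sp"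
proof -
  define l where "l = lp + x"
  define N where "N = (\<mu> - l) * (\<mu> * Sp * (\<mu> - lp) - \<psi> * l)"
  define D where "D = \<psi> * l\<^sup>2 - \<mu> * Sp * lp * (\<mu> - l)"
  have \<beta>: "\<beta> = N / D" by (simp add: \<beta>_def N_def D_def l_def)
  have l: "0 < l" "l < \<mu>" "lp < l" using x lp_pos by (auto simp: l_def)
  have le': "Sp * \<mu> * (\<mu> - l) \<le> \<psi> * l"
    using le l mu_pos by (simp add: l_def[symmetric] field_simps)
  have ge': "\<psi> * l \<le> \<mu> * Sp * (\<mu> - lp)"
    using ge lp_less mu_pos by (simp add: l_def[symmetric] field_simps)
  have "lp * (Sp * \<mu> * (\<mu> - l)) \<le> lp * (\<psi> * l)" using le' lp_pos by simp
  moreover have "lp * (\<psi> * l) < l * (\<psi> * l)"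
    using l psi_pos by (intro mult_strict_right_mono) auto
  ultimately have D: "D > 0"
    by (simp add: D_def power2_eq_square algebra_simps)
  have N: "N \<ge> 0" unfolding N_def using ge' l by simp
  have DN: "D - N = \<mu> * (\<psi> * l - Sp * \<mu> * (\<mu> - l))"
    by (simp add: N_def D_def algebra_simps power2_eq_square)
  moreover have "0 \<le> \<mu> * (\<psi> * l - Sp * \<mu> * (\<mu> - l))" using le' mu_pos by simp
  ultimately have "N \<le> D" by linarith
  then have b1: "\<beta> \<le> 1" using D by (simp add: \<beta>)
  show b0: "0 \<le> \<beta>" using D N by (simp add: \<beta>)
  have u: "1 - \<beta> = \<mu> * (\<psi> * l - Sp * \<mu> * (\<mu> - l)) / D"
    using D by (simp add: \<beta> DN[symmetric] diff_divide_distrib)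
  \<comment> \<open>Since \<open>1 - \<beta> = (D - N) / D\<close>, this identity and the next show
    that both parameter-dependent factors of \<open>W_p\<close> carry \<open>\<mu> * x / D\<close>,
    which cancels.\<close>
  have "\<mu> * D - l * (D - N) = \<mu> * (\<mu> - l) * Sp * (\<mu> * x)"
    by (simp add: DN) (simp add: D_def l_def algebra_simps power2_eq_square)
  then have n: "\<mu> - l * (1 - \<beta>) = \<mu> * (\<mu> - l) * Sp * (\<mu> * x) / D"
    using D unfolding u DN[symmetric] by (simp add: field_simps)
  have "\<mu> * D - lp * (D - N) = \<psi> * l * (\<mu> * x)"
    by (simp add: DN) (simp add: D_def l_def algebra_simps power2_eq_square)
  then have d: "\<mu> - lp * (1 - \<beta>) = \<psi> * l * (\<mu> * x) / D"
    using D unfolding u DN[symmetric] by (simp add: field_simps)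
  have "W_p \<mu> \<psi> lp x (ereal \<beta>) = l * \<psi> * (\<mu> - l * (1 - \<beta>)) / (\<mu> * (\<mu> - l) * (\<mu> - lp * (1 - \<beta>)))"
    using b1 by (simp add: W_p_def Let_def l_def one_ereal_def)
  also have "\<dots> = Sp"
    unfolding n d using l x D mu_pos psi_pos by simp
  finally show "W_p \<mu> \<psi> lp x (ereal \<beta>) = Sp" .
qed

text \<open>Here the bounds are the values at \<open>\<beta> = 1\<close> and
  \<open>\<beta> = \<infinity>\<close>. The strict upper one keeps \<open>D\<close> positive, hence
  the solution finite; the lower one gives \<open>D < N\<close>. The equation is solved for
  \<open>1 / \<beta> = D / N\<close>.\<close>

lemma W_p_intermediate_gt_1:
  assumes x: "0 < x" "x < \<mu> - lp"
    and gt: "\<psi> * (lp + x) / (\<mu> * (\<mu> - (lp + x))) < Sp"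
    and less: "Sp < \<psi> * (lp + x) / ((\<mu> - x) * (\<mu> - (lp + x)))"
  defines "\<beta> \<equiv> Sp * x * (\<mu> - (lp + x)) / (\<psi> * (lp + x) - Sp * (\<mu> - x) * (\<mu> - (lp + x)))"
  shows "0 \<le> \<beta>" "W_p \<mu> \<psi> lp x (ereal \<beta>) = Sp"
proof -
  define l where "l = lp + x"
  define N where "N = Sp * x * (\<mu> - l)"
  define D where "D = \<psi> * l - Sp * (\<mu> - x) * (\<mu> - l)"
  have \<beta>: "\<beta> = N / D" by (simp add: \<beta>_def N_def D_def l_def)
  have l: "0 < l" "l < \<mu>" "x < \<mu>" using x lp_pos by (auto simp: l_def)
  have D: "D > 0"
    using less l by (simp add: D_def l_def[symmetric] pos_less_divide_eq mult.assoc)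
  have N: "N > 0" using Sp_pos x l by (simp add: N_def)
  have "\<psi> * l < Sp * (\<mu> * (\<mu> - l))"
    using gt l mu_pos by (simp add: l_def[symmetric] field_simps)
  then have "D < N" by (simp add: D_def N_def algebra_simps)
  then have b1: "1 < \<beta>" using D by (simp add: \<beta>)
  then show "0 \<le> \<beta>" by simp
  have inv: "real_of_ereal (1 / ereal \<beta>) = D / N"
    using b1 by (simp add: \<beta> one_ereal_def)
  have "x * (1 - D / N) = (Sp * \<mu> * (\<mu> - l) - \<psi> * l) / (Sp * (\<mu> - l))"
    using N x l Sp_pos by (simp add: N_def D_def field_simps)
  then have d: "\<mu> - x * (1 - D / N) = \<psi> * l / (Sp * (\<mu> - l))"
    using l Sp_pos by (simp add: field_simps)
  have "W_p \<mu> \<psi> lp x (ereal \<beta>) = l * \<psi> / ((\<mu> - l) * (\<mu> - x * (1 - D / N)))"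
    using b1 unfolding W_p_def Let_def inv by (simp add: l_def one_ereal_def)
  also have "\<dots> = Sp"
    unfolding d using l Sp_pos psi_pos by simp
  finally show "W_p \<mu> \<psi> lp x (ereal \<beta>) = Sp" .
qed

section \<open>Optimality of every branch of the algorithm\<close>

text \<open>With the primary constraint tight the revenue equals \<open>R2 x\<close>, so the tangent
  of \<open>R2\<close> dominates the rates on its descending side. At
  \<open>\<beta> = \<infinity>\<close> it also equals \<open>R1 x\<close>, and a nonnegative slope
  of \<open>R1\<close> handles smaller rates.\<close>

lemma optimal_if_tight:
  assumes "0 < x" "x < \<mu> - lp" "0 \<le> \<beta>" "W_p \<mu> \<psi> lp x \<beta> = Sp"
    and "\<And>y \<gamma>. admissible y \<gamma> \<Longrightarrow> 0 \<le> R2' x * (x - y) \<or> y \<le> x \<and> \<beta> = \<infinity> \<and> 0 \<le> R1' x"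
  shows "optimal x \<beta>"
  unfolding optimal_def
proof (intro conjI allI impI)
  show "0 < x" by fact
  show "admissible x \<beta>" using assms by (simp add: admissible_def)
  fix y \<gamma> assume y: "admissible y \<gamma>"
  then have y': "y < \<mu> - lp" by (simp add: admissible_def)
  from assms(5)[OF y] show "scaled_rev y \<gamma> \<le> scaled_rev x \<beta>"
  proof
    assume "0 \<le> R2' x * (x - y)"
    then have "R2 y \<le> R2 x" using R2_tangent[OF assms(2) y'] by (simp add: algebra_simps)
    then show ?thesis using scaled_rev_le_R2[OF y] scaled_rev_eq[of x \<beta>] assms by simp
  next
    assume A: "y \<le> x \<and> \<beta> = \<infinity> \<and> 0 \<le> R1' x"
    then have "R1' x * (y - x) \<le> 0" by (simp add: mult_nonneg_nonpos)
    then have "R1 y \<le> R1 x"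
      using R1_tangent[of x y] assms y' lp_pos by simp
    then show ?thesis using scaled_rev_le_R1[OF y] scaled_rev_eq_R1[of x] A assms by simp
  qed
qed

text \<open>At the crossing point smaller rates are controlled by \<open>R1\<close> and larger ones
  by \<open>R2\<close>.\<close>

lemma optimal_ls4:
  assumes "0 \<le> R1' (ls4 \<mu> \<psi> lp Sp)" "R2' (ls4 \<mu> \<psi> lp Sp) \<le> 0"
  shows "optimal (ls4 \<mu> \<psi> lp Sp) \<infinity>"
proof (rule optimal_if_tight)
  fix y
  show "0 \<le> R2' (ls4 \<mu> \<psi> lp Sp) * (ls4 \<mu> \<psi> lp Sp - y) \<or>
      y \<le> ls4 \<mu> \<psi> lp Sp \<and> (\<infinity>::ereal) = \<infinity> \<and> 0 \<le> R1' (ls4 \<mu> \<psi> lp Sp)"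
    using assms by (cases "y \<le> ls4 \<mu> \<psi> lp Sp") (auto intro: mult_nonpos_nonpos)
qed (use ls4_props in auto)

text \<open>Let \<open>z\<close> be the peak of \<open>R2\<close>. For \<open>Sp < I_l\<close> it is
  out of reach even at \<open>\<beta> = 0\<close>; up to \<open>I_u\<close> some
  \<open>\<beta>\<close> attains it with \<open>W_p = Sp\<close>; from \<open>I_u\<close> on the
  crossing point lies at or beyond it.\<close>

lemma optimal_step_C:
  assumes B: "\<not> a / c \<le> lp * (2 * \<mu> - lp) / (\<mu> * (\<mu> - lp) ^ 2) * \<psi>"
    and R1': "0 \<le> R1' (ls4 \<mu> \<psi> lp Sp)"
    and xb: "step_C \<mu> \<psi> lp a c Sp = (x, \<beta>)"
  shows "optimal x \<beta>"
proof -
  define z where "z = ls1 \<mu> \<psi> lp a c"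
  have z: "0 < z" "z < \<mu> - lp" "R2' z = 0" using ls1_root[OF B] by (auto simp: z_def)
  define I_l where "I_l = \<psi> * (lp + z) / (\<mu> * (\<mu> - lp))"
  define I_u where "I_u = \<psi> * (lp + z) / ((\<mu> - z) * (\<mu> - (lp + z)))"
  define M where "M = \<psi> * (lp + z) / (\<mu> * (\<mu> - (lp + z)))"
  define \<beta>1 where "\<beta>1 = (\<mu> - (lp + z)) * (\<mu> * Sp * (\<mu> - lp) - \<psi> * (lp + z))
                         / (\<psi> * (lp + z) ^ 2 - \<mu> * Sp * lp * (\<mu> - (lp + z)))"
  define \<beta>2 where "\<beta>2 = Sp * z * (\<mu> - (lp + z)) / (\<psi> * (lp + z) - Sp * (\<mu> - z) * (\<mu> - (lp + z)))"
  have step: "(x, \<beta>) = (if Sp < I_l then (\<mu> * (\<mu> - lp) * Sp / \<psi> - lp, 0)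
       else if Sp < I_u then (z, if Sp \<le> M then ereal \<beta>1 else ereal \<beta>2)
       else (ls4 \<mu> \<psi> lp Sp, \<infinity>))"
    unfolding xb[symmetric] step_C_def Let_def I_l_def I_u_def M_def \<beta>1_def \<beta>2_def z_def by simp
  consider "Sp < I_l" | "I_l \<le> Sp" "Sp < I_u" "Sp \<le> M" | "I_l \<le> Sp" "Sp < I_u" "M < Sp"
    | "I_l \<le> Sp" "I_u \<le> Sp" by linarith
  then show ?thesis
  proof cases
    case 1
    then have x: "x = \<mu> * (\<mu> - lp) * Sp / \<psi> - lp" "\<beta> = 0" using step by auto
    have "x < z" using 1 psi_pos mu_pos lp_less by (simp add: x I_l_def field_simps)
    have "0 < x" using Sp_gt psi_pos mu_pos lp_less by (simp add: x field_simps)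
    have Sp: "(lp + x) * \<psi> / (\<mu> * (\<mu> - lp)) = Sp"
      using psi_pos mu_pos lp_less by (simp add: x)
    show ?thesis
    proof (rule optimal_if_tight)
      show "W_p \<mu> \<psi> lp x \<beta> = Sp"
        using Sp \<open>x < z\<close> z by (simp add: W_p_def Let_def x(2))
      fix y \<gamma> assume y: "admissible y \<gamma>"
      \<comment> \<open>No priority beats \<open>\<beta> = 0\<close> for the primary class, so
        \<open>x\<close> is the largest admissible rate, and \<open>R2\<close> still rises
        there.\<close>
      then have "(lp + y) * \<psi> / (\<mu> * (\<mu> - lp)) \<le> Sp"
        using W_p_ge_zero_priority[of lp y \<mu> \<gamma> \<psi>] lp_pos psi_pos by (auto simp: admissible_def)
      then have "y \<le> x" using psi_pos mu_pos lp_less by (simp add: x field_simps)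
      moreover have "0 \<le> R2' x"
        using R2'_strict_antimono[OF \<open>x < z\<close> z(2)] z(3) by simp
      ultimately show "0 \<le> R2' x * (x - y) \<or> y \<le> x \<and> \<beta> = \<infinity> \<and> 0 \<le> R1' x" by simp
    qed (use \<open>0 < x\<close> \<open>x < z\<close> z x in auto)
  next
    case 2
    then have x: "x = z" "\<beta> = ereal \<beta>1" using step by auto
    show ?thesis
      using W_p_intermediate_le_1[of z] z 2 unfolding x
      by (intro optimal_if_tight) (auto simp: I_l_def M_def \<beta>1_def)
  next
    case 3
    then have x: "x = z" "\<beta> = ereal \<beta>2" using step by auto
    show ?thesis
      using W_p_intermediate_gt_1[of z] z 3 unfolding x
      by (intro optimal_if_tight) (auto simp: I_u_def M_def \<beta>2_def)
  next
    case 4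
    then have x: "x = ls4 \<mu> \<psi> lp Sp" "\<beta> = \<infinity>" using step by auto
    have "W_p \<mu> \<psi> lp z \<infinity> \<le> Sp" using 4 by (simp add: W_p_top I_u_def mult.commute diff_diff_eq)
    then have "z \<le> ls4 \<mu> \<psi> lp Sp"
      using W_p_top_strict_mono[of "ls4 \<mu> \<psi> lp Sp" z] ls4_props z by force
    then have "R2' (ls4 \<mu> \<psi> lp Sp) \<le> 0"
      using R2'_strict_antimono[of z "ls4 \<mu> \<psi> lp Sp"] ls4_props z by force
    then show ?thesis unfolding x using R1' by (rule optimal_ls4[rotated])
  qed
qed

text \<open>A finite \<open>J_l\<close> is the primary waiting time at the peak of \<open>R1\<close>
  under \<open>\<beta> = \<infinity>\<close>. If \<open>Sp\<close> exceeds it, that peak is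
  admissible and attains the bound.\<close>

lemma optimal_steps_A_to_C:
  assumes xb: "steps_A_to_C \<mu> \<psi> lp a c Sp = (x, \<beta>)"
  shows "optimal x \<beta>"
proof -
  define z where "z = ls3 \<mu> \<psi> lp a c"
  have J: "J_l \<mu> \<psi> lp a c = (if 0 \<le> R1' (\<mu> - lp) then \<infinity> else ereal (W_p \<mu> \<psi> lp z \<infinity>))"
    unfolding J_l_def step_A_test_iff Let_def W_p_top z_def by (simp add: mult.commute diff_diff_eq)
  show ?thesis
  proof (cases "J_l \<mu> \<psi> lp a c < ereal Sp")
    case True
    then have neg: "R1' (\<mu> - lp) < 0" and Sp: "W_p \<mu> \<psi> lp z \<infinity> < Sp"
      by (auto simp: J not_le split: if_splits)
    have z: "0 < z" "z < \<mu> - lp" "R1' z = 0" using ls3_root[OF neg] by (auto simp: z_def)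
    have x: "x = z" "\<beta> = \<infinity>" using True xb by (auto simp: steps_A_to_C_def z_def)
    have "scaled_rev y \<gamma> \<le> scaled_rev z \<infinity>" if y: "admissible y \<gamma>" for y \<gamma>
      using scaled_rev_le_R1[OF y] R1_tangent[of z y] z y lp_pos
      by (simp add: scaled_rev_eq_R1 admissible_def)
    then show ?thesis unfolding x optimal_def using z Sp by (simp add: admissible_def)
  next
    case False
    \<comment> \<open>Either \<open>R1\<close> rises up to the stability limit, or its peak is not
      before the crossing point. Steps B and C both rely on this sign.\<close>
    have R1': "0 \<le> R1' (ls4 \<mu> \<psi> lp Sp)"
    proof (cases "0 \<le> R1' (\<mu> - lp)")
      case True
      then show ?thesis
        using R1'_strict_antimono[of "ls4 \<mu> \<psi> lp Sp" "\<mu> - lp"] ls4_props lp_pos by simp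
    next
      case neg: False
      then have z: "0 < z" "z < \<mu> - lp" "R1' z = 0" using ls3_root by (auto simp: z_def)
      have "Sp \<le> W_p \<mu> \<psi> lp z \<infinity>" using False neg by (simp add: J not_less)
      then have "ls4 \<mu> \<psi> lp Sp \<le> z"
        using W_p_top_strict_mono[of z "ls4 \<mu> \<psi> lp Sp"] ls4_props z by force
      then show ?thesis
        using R1'_strict_antimono[of "ls4 \<mu> \<psi> lp Sp" z] z lp_pos by force
    qed
    show ?thesis
    proof (cases "a / c \<le> lp * (2 * \<mu> - lp) / (\<mu> * (\<mu> - lp) ^ 2) * \<psi>")
      case True
      then have x: "x = ls4 \<mu> \<psi> lp Sp" "\<beta> = \<infinity>" using False xb by (auto simp: steps_A_to_C_def)
      \<comment> \<open>The test of Step B says that \<open>R2\<close> does not rise at rate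
        \<open>0\<close>, so by concavity it falls at the crossing point.\<close>
      have "a * (\<mu> * (\<mu> - lp)\<^sup>2) \<le> c * \<psi> * lp * (2 * \<mu> - lp)"
        using True c_pos mu_pos lp_less by (simp add: field_simps)
      then have "0 \<le> G \<mu> \<psi> lp a c 0"
        unfolding G_def Let_def by (simp add: algebra_simps)
      then have "R2' 0 \<le> 0"
        using G_eq[of 0] lp_less mu_pos by (simp add: mult_le_0_iff)
      then have "R2' (ls4 \<mu> \<psi> lp Sp) \<le> 0"
        using R2'_strict_antimono[of 0 "ls4 \<mu> \<psi> lp Sp"] ls4_props by simp
      then show ?thesis unfolding x using R1' by (rule optimal_ls4[rotated])
    next
      case nB: False
      then show ?thesis
        using optimal_step_C[OF nB R1'] False xb by (simp add: steps_A_to_C_def)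
    qed
  qed
qed

end

theorem theorem4p1:
  fixes \<mu> \<sigma> \<psi> lp a b c Sp ls_opt \<theta>_opt Ss_opt :: real and \<beta>_opt :: ereal
  assumes "0 < lp" and "lp < \<mu>"
    and "0 \<le> \<sigma>"
    and "0 < a" and "0 < b" and "0 < c"
    and "\<psi> = (1 + \<sigma> ^ 2 * \<mu> ^ 2) / 2"
    and "Sp > lp * \<psi> / (\<mu> * (\<mu> - lp))"
    and "a / c > lp / \<mu> ^ 2 * \<psi>"
    and "(ls_opt, \<theta>_opt, Ss_opt, \<beta>_opt) = finite_step_algorithm \<mu> \<psi> lp a b c Sp"
  shows "nash_equilibrium \<mu> \<psi> lp a b c Sp (ls_opt, \<theta>_opt, Ss_opt, \<beta>_opt) \<and>
    (\<forall>ls \<theta> Ss \<beta>. nash_equilibrium \<mu> \<psi> lp a b c Sp (ls, \<theta>, Ss, \<beta>) \<longrightarrow>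
       \<theta>_opt * ls_opt \<ge> \<theta> * ls)"
proof -
  have "0 < \<psi>" unfolding assms(7) by (intro divide_pos_pos add_pos_nonneg) auto
  interpret pricing_model \<mu> \<psi> lp a b c Sp
    using assms \<open>0 < \<psi>\<close> by unfold_locales auto
  have "steps_A_to_C \<mu> \<psi> lp a c Sp = (ls_opt, \<beta>_opt)"
    and out: "Ss_opt = W_s \<mu> \<psi> lp ls_opt \<beta>_opt" "\<theta>_opt = (a - c * Ss_opt - ls_opt) / b"
    using assms(10) by (auto simp: finite_step_algorithm_def Let_def split: prod.splits)
  then have "optimal ls_opt \<beta>_opt" by (intro optimal_steps_A_to_C)
  from optimal_nash[OF this] show ?thesis unfolding out by blast
qed

end
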